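(* Let $q>1$ and $r=\frac{q}{q-1}$. Assume that for every $x\in\mathbb{R}^n$ $$f(x)=\mathbb{E}_\xi[F(x,\xi)],\qquad \mathbb{E}_\xi\left[|F(x,\xi)-f(x)|^r\right]\le M_r<+\infty ,$$ with $M_r$ independent of $x$. Then the tail bound condition with exponent $q$ (defined in the context) can be satisfied by sample-average estimates (see context) using (i) $O(\Delta_k^{-q^2})$ i.i.d. samples at iteration $k$, if $q>2$; (ii) $O(\Delta_k^{-2q})$ i.i.d. samples at iteration $k$, if $q\in(1,2]$. Here "can be satisfied using $O(\Delta_k^{-s})$ i.i.d. samples" means: there are a function $p:(0,\infty)\to\{1,2,3,\dots\}$ with $p(\delta)=O(\delta^{-s})$ as $\delta\to0^+$ and a constant $\varepsilon_q>0$ such that, if for every $k$ the estimates $F_k$ and $F_k^g$ are sample averages with $p_k=p(\Delta_k)$ samples each, then the tail bound condition holds with the constant $\varepsilon_q$.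
   Context: $f:\mathbb{R}^n\to\mathbb{R}$ is locally Lipschitz continuous with $\inf f=f^*\in\mathbb{R}$, and $F(x,\xi)$ is a stochastic oracle, where $\xi$ is a random variable that can be sampled. On a probability space, a stochastic derivative-free algorithm generates, for $k=0,1,2,\dots$, random iterates $X_k\in\mathbb{R}^n$, random stepsizes $\Delta_k>0$, random directions $G_k\in\mathbb{R}^n$, and real random variables $F_k$, $F_k^g$ which are estimates of $f(X_k)$ and $f(X_k+\Delta_kG_k)$ respectively. $\mathcal{F}_{k-1}$ is the $\sigma$-algebra generated by $(F_j,F_j^g)_{j=0}^{k-1}$ and $(G_j)_{j=0}^{k}$. $X_0$ and $\Delta_0$ are deterministic and $(X_{k+1},\Delta_{k+1})$ is determined by $(X_k,\Delta_k,G_k,F_k,F_k^g)$, so $X_k,\Delta_k,G_k$ are $\mathcal{F}_{k-1}$-measurable. Tail bound condition with exponent $q>1$: for some $\varepsilon_q>0$ (independent of $k$), for every $k$ and every $\alpha>0$, almost surely $$\mathbb{P}\left(|F_k-F_k^g-(f(X_k)-f(X_k+\Delta_kG_k))|\ge \alpha\Delta_k^q \,\middle|\, \mathcal{F}_{k-1}\right)\le \frac{\varepsilon_q}{\alpha^{q/(q-1)}} .$$ Sample-average estimates with $p_k$ samples: $F_k=\frac1{p_k}\sum_{i=1}^{p_k}F(X_k,\xi_{k,i})$ and $F_k^g=\frac1{p_k}\sum_{i=1}^{p_k}F(X_k+\Delta_kG_k,\xi^g_{k,i})$, where $\xi_{k,i},\xi^g_{k,i}$ are i.i.d. copies of $\xi$,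 independent of $\mathcal{F}_{k-1}$. *)

theory Defs
  imports "HOL-Probability.Probability"
begin

text \<open>Conventions: \<open>'n\<close> indexes the coordinates of the search space, elements of \<open>'w\<close> are
  outcomes of the algorithm, elements of \<open>'s\<close> are values of the random variable fed to the oracle.
  \<open>D k\<close> is the stepsize, \<open>Fe k\<close> estimates \<open>f\<close> at \<open>X k\<close> and \<open>Fg k\<close> estimates \<open>f\<close> at
  \<open>X k + D k *\<^sub>R G k\<close>.\<close>

text \<open>\<open>history M G Fe Fg k\<close> is the sigma-algebra written $\mathcal{F}_{k-1}$ in the literature:
  generated by the estimates of iterations \<open>< k\<close> and the directions of iterations \<open>\<le> k\<close>.\<close>

definition history ::
  "'w measure \<Rightarrow> (nat \<Rightarrow> 'w \<Rightarrow> real ^ 'n) \<Rightarrow> (nat \<Rightarrow> 'w \<Rightarrow> real) \<Rightarrow> (nat \<Rightarrow> 'w \<Rightarrow> real) \<Rightarrow> nat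
    \<Rightarrow> 'w measure"
  where "history M G Fe Fg k = sigma (space M)
     ({Fe j -` B \<inter> space M | j B. j < k \<and> B \<in> sets borel}
    \<union> {Fg j -` B \<inter> space M | j B. j < k \<and> B \<in> sets borel}
    \<union> {G j -` B \<inter> space M | j B. j \<le> k \<and> B \<in> sets borel})"

text \<open>That \<open>X (Suc k)\<close> and \<open>D (Suc k)\<close> are determined by the data of iteration \<open>k\<close> is expressed by
  a Borel measurable update map \<open>U k\<close>; together with the deterministic start this makes \<open>X k\<close> and
  \<open>D k\<close> measurable with respect to \<open>history M G Fe Fg k\<close>.\<close>

locale stochastic_dfo = prob_space M
  for M :: "'w measure" +
  fixes U :: "nat \<Rightarrow> (real ^ 'n) \<times> real \<times> (real ^ 'n) \<times> real \<times> real \<Rightarrow> (real ^ 'n) \<times> real"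
    and X :: "nat \<Rightarrow> 'w \<Rightarrow> real ^ 'n"
    and D :: "nat \<Rightarrow> 'w \<Rightarrow> real"
    and G :: "nat \<Rightarrow> 'w \<Rightarrow> real ^ 'n"
    and Fe Fg :: "nat \<Rightarrow> 'w \<Rightarrow> real"
  assumes G_measurable: "\<And>k. random_variable borel (G k)"
    and Fe_measurable: "\<And>k. random_variable borel (Fe k)"
    and Fg_measurable: "\<And>k. random_variable borel (Fg k)"
    and X_0_deterministic: "\<exists>x0. \<forall>\<omega>\<in>space M. X 0 \<omega> = x0"
    and D_0_deterministic: "\<exists>d0. \<forall>\<omega>\<in>space M. D 0 \<omega> = d0"
    and U_measurable: "\<And>k. U k \<in> borel_measurable borel"
    and update: "\<And>k \<omega>. \<omega> \<in> space M \<Longrightarrow>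
      (X (Suc k) \<omega>, D (Suc k) \<omega>) = U k (X k \<omega>, D k \<omega>, G k \<omega>, Fe k \<omega>, Fg k \<omega>)"
    and D_pos: "\<And>k \<omega>. \<omega> \<in> space M \<Longrightarrow> D k \<omega> > 0"

text \<open>The conditional probability of an event is the conditional expectation of its indicator.\<close>

definition tail_bound_condition ::
  "'w measure \<Rightarrow> (real ^ 'n \<Rightarrow> real) \<Rightarrow> real \<Rightarrow> real \<Rightarrow> (nat \<Rightarrow> 'w \<Rightarrow> real ^ 'n) \<Rightarrow> (nat \<Rightarrow> 'w \<Rightarrow> real)
    \<Rightarrow> (nat \<Rightarrow> 'w \<Rightarrow> real ^ 'n) \<Rightarrow> (nat \<Rightarrow> 'w \<Rightarrow> real) \<Rightarrow> (nat \<Rightarrow> 'w \<Rightarrow> real) \<Rightarrow> bool"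
  where "tail_bound_condition M f q \<epsilon> X D G Fe Fg \<longleftrightarrow>
    (\<forall>k. \<forall>\<alpha>>0. AE \<omega> in M.
      real_cond_exp M (history M G Fe Fg k)
        (indicator {\<omega> \<in> space M.
          \<bar>Fe k \<omega> - Fg k \<omega> - (f (X k \<omega>) - f (X k \<omega> + D k \<omega> *\<^sub>R G k \<omega>))\<bar> \<ge> \<alpha> * D k \<omega> powr q}) \<omega>
      \<le> \<epsilon> / \<alpha> powr (q / (q - 1)))"

text \<open>\<open>Xi\<close> is the law of the oracle's random variable, \<open>N\<close> the measurable space of its values.
  For each \<open>k\<close> the samples \<open>xis k i\<close>, \<open>xigs k i\<close> (\<open>i \<ge> 1\<close>) form one jointly independent family
  with common law \<open>Xi\<close>, and the sigma-algebra generated by the whole family is independent of the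
  history. An infinite supply of samples is provided since the sample size depends on the random
  stepsize. Independence of samples across different \<open>k\<close> is not required.\<close>

definition sample_average_estimates ::
  "'w measure \<Rightarrow> 's measure \<Rightarrow> 's measure \<Rightarrow> (real ^ 'n \<Rightarrow> 's \<Rightarrow> real) \<Rightarrow> (real \<Rightarrow> nat)
    \<Rightarrow> (nat \<Rightarrow> 'w \<Rightarrow> real ^ 'n) \<Rightarrow> (nat \<Rightarrow> 'w \<Rightarrow> real) \<Rightarrow> (nat \<Rightarrow> 'w \<Rightarrow> real ^ 'n)
    \<Rightarrow> (nat \<Rightarrow> 'w \<Rightarrow> real) \<Rightarrow> (nat \<Rightarrow> 'w \<Rightarrow> real) \<Rightarrow> bool"
  where "sample_average_estimates M N Xi F p X D G Fe Fg \<longleftrightarrow>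
    (\<exists>xis xigs :: nat \<Rightarrow> nat \<Rightarrow> 'w \<Rightarrow> 's. \<forall>k.
      prob_space.indep_vars M (\<lambda>_. N) (case_sum (xis k) (xigs k)) ({1..} <+> {1..}) \<and>
      (\<forall>i\<ge>1. distr M N (xis k i) = Xi \<and> distr M N (xigs k i) = Xi) \<and>
      prob_space.indep_set M
        (sets (history M G Fe Fg k))
        (sigma_sets (space M)
          ({xis k i -` A \<inter> space M | i A. i \<ge> 1 \<and> A \<in> sets N}
         \<union> {xigs k i -` A \<inter> space M | i A. i \<ge> 1 \<and> A \<in> sets N})) \<and>
      (\<forall>\<omega>\<in>space M.
        Fe k \<omega> = (\<Sum>i = 1..p (D k \<omega>). F (X k \<omega>) (xis k i \<omega>)) / real (p (D k \<omega>)) \<and>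
        Fg k \<omega> = (\<Sum>i = 1..p (D k \<omega>). F (X k \<omega> + D k \<omega> *\<^sub>R G k \<omega>) (xigs k i \<omega>))
                  / real (p (D k \<omega>))))"

text \<open>The tail bound condition with exponent \<open>q\<close> can be satisfied using $O(\Delta_k^{-s})$ samples. The
  first argument only fixes the type of outcomes; the sample size function \<open>p\<close> and the constant
  \<open>\<epsilon>\<close> are chosen before the probability space and the run of the algorithm. The values of
  \<open>p\<close> outside the positive reals are irrelevant.\<close>

definition tail_bound_satisfiable ::
  "'w itself \<Rightarrow> 's measure \<Rightarrow> 's measure \<Rightarrow> (real ^ 'n \<Rightarrow> real) \<Rightarrow> (real ^ 'n \<Rightarrow> 's \<Rightarrow> real)
    \<Rightarrow> real \<Rightarrow> real \<Rightarrow> bool"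
  where "tail_bound_satisfiable TYPE('w) N Xi f F q s \<longleftrightarrow>
    (\<exists>(p :: real \<Rightarrow> nat) (\<epsilon> :: real).
      (\<forall>\<delta>>0. p \<delta> \<ge> 1) \<and>
      (\<lambda>\<delta>. real (p \<delta>)) \<in> O[at_right 0](\<lambda>\<delta>. \<delta> powr (- s)) \<and>
      \<epsilon> > 0 \<and>
      (\<forall>(M :: 'w measure) U X D G Fe Fg.
        stochastic_dfo M U X D G Fe Fg \<and> sample_average_estimates M N Xi F p X D G Fe Fg \<longrightarrow>
        tail_bound_condition M f q \<epsilon> X D G Fe Fg))"

end

theory Submission
  imports Defs
begin

text \<open>Let $r = q/(q-1)$. By Markov's inequality for the $r$-th moment, the tail bound condition
  follows if the error of $F_k - F_k^g$ has conditional $r$-th absolute moment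
  $O(\Delta_k^{qr})$: the power $\alpha^{-r}$ in the condition is the one that Markov's inequality
  produces. What must be known is how fast the $r$-th moment of a sample average decreases with the
  number $n$ of samples.

  For independent centred variables with $r$-th moments at most $B$, the $r$-th moment of a sum of
  $n$ terms is $O(B n^e)$ with $e = \max(1, r/2)$ (\<open>moment_sum_bound\<close>). For $r < 2$ the variables
  need not have a variance, and the bound grows linearly; for $r \ge 2$ it has the rate $n^{r/2}$ of
  the central limit theorem. Both come from the single pointwise inequality
  \<open>powr_tangent_bound\<close>, an expansion of $|x+y|^r$ around $x$ whose linear term has mean zero
  when $y$ is independent of $x$ and centred; adding the variables one at a time gives the
  bound by induction.

  The average therefore has $r$-th moment $O(n^{e-r})$, and $n \ge \Delta^{-s}$ samples are enough
  when $s (r - e) = q r$. If $q > 2$, then $r < 2$, $e = 1$ and $s = q^2$; if $q \le 2$, then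
  $r \ge 2$, $e = r/2$ and $s = 2q$.

  All this concerns deterministic points and stepsizes. It carries over to the algorithm because
  the samples of iteration $k$ are independent of the history, with respect to which the iterate,
  the stepsize and the direction are measurable: conditionally on the history these
  can be treated as constants (\<open>real_cond_exp_indicator_freeze\<close>).\<close>

section \<open>A first-order expansion of powers with a controlled remainder\<close>

text \<open>On $|u| \le 1/2$ the second derivative of $(1+u)^r$ stays bounded even when $r < 2$, because
  $1 + u$ keeps away from the singularity at 0; Taylor's formula then gives a quadratic remainder.\<close>

lemma powr_quadratic_bound:
  fixes r :: real
  assumes "r > 1"
  obtains A where "A \<ge> 1"
    and "\<And>u. \<bar>u\<bar> \<le> 1 / 2 \<Longrightarrow> (1 + u) powr r \<le> 1 + r * u + A * u\<^sup>2"
proof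
  define A where "A = 1 + r * (r - 1) / 2 * 2 powr \<bar>r - 2\<bar>"
  show "A \<ge> 1"
    using assms by (simp add: A_def)
  fix u :: real
  assume u: "\<bar>u\<bar> \<le> 1 / 2"
  show "(1 + u) powr r \<le> 1 + r * u + A * u\<^sup>2"
  proof (cases "u = 0")
    case False
    define d :: "nat \<Rightarrow> real \<Rightarrow> real" where "d = (\<lambda>m t. if m = 0 then t powr r
      else if m = 1 then r * t powr (r - 1) else r * (r - 1) * t powr (r - 2 :: real))"
    have "\<exists>t. (if 1 + u < 1 then 1 + u < t \<and> t < 1 else 1 < t \<and> t < 1 + u) \<and>
        (1 + u) powr r = (\<Sum>m<2. d m 1 / fact m * (1 + u - 1) ^ m)
          + d 2 t / fact 2 * (1 + u - 1) ^ 2"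
    proof (rule Taylor[where a = "1/2" and b = "3/2"])
      show "\<forall>m t. m < 2 \<and> 1 / 2 \<le> t \<and> t \<le> 3 / 2 \<longrightarrow> DERIV (d m) t :> d (Suc m) t"
      proof (intro allI impI)
        fix m :: nat and t :: real
        assume t: "m < 2 \<and> 1 / 2 \<le> t \<and> t \<le> 3 / 2"
        then have "t > 0" by simp
        from t have "m = 0 \<or> m = 1" by auto
        with \<open>t > 0\<close> show "DERIV (d m) t :> d (Suc m) t"
          by (auto simp: d_def intro!: derivative_eq_intros)
      qed
    qed (use u False in \<open>auto simp: d_def\<close>)
    then obtain t where t0: "if 1 + u < 1 then 1 + u < t \<and> t < 1 else 1 < t \<and> t < 1 + u"
      and taylor: "(1 + u) powr r = (\<Sum>m<2. d m 1 / fact m * (1 + u - 1) ^ m)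
        + d 2 t / fact 2 * (1 + u - 1) ^ 2"
      by blast
    have t: "1 / 2 \<le> t" "t \<le> 2"
      using t0 u by (auto split: if_splits)
    have eq: "(1 + u) powr r = 1 + r * u + r * (r - 1) * t powr (r - 2) / 2 * u\<^sup>2"
      using taylor by (simp add: d_def numeral_2_eq_2)
    have "t powr (r - 2) \<le> 2 powr \<bar>r - 2\<bar>"
    proof (cases "r \<ge> 2")
      case True
      then show ?thesis
        using t by (simp add: powr_mono2)
    next
      case False
      have "t powr (r - 2) \<le> (1 / 2) powr (r - 2)"
        using t False by (intro powr_mono2') auto
      also have "\<dots> = 2 powr \<bar>r - 2\<bar>"
        using False by (simp add: powr_divide powr_minus_divide[symmetric])
      finally show ?thesis .
    qed
    then have "r * (r - 1) / 2 * t powr (r - 2) \<le> r * (r - 1) / 2 * 2 powr \<bar>r - 2\<bar>"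
      using assms by (intro mult_left_mono) auto
    then have "r * (r - 1) * t powr (r - 2) / 2 \<le> A"
      by (simp add: A_def)
    then show ?thesis
      unfolding eq by (intro add_left_mono mult_right_mono) auto
  qed simp
qed

text \<open>A remainder of order $u^2$ is what one gets near 0, one of order $|u|^r$ far from 0. For
  $r \le 2$ the second dominates the first near 0 as well. For $r > 2$ it does not, and no multiple
  of $|u|^r$ suffices; but once $A u^2$ exceeds a tolerance $\eta$, $|u|$ is bounded below and
  $u^2 = |u|^{2-r} |u|^r$ is at most a multiple of $\eta^{1-r/2} |u|^r$. The exponent
  $\max(1, r/2)$ records both regimes.\<close>

lemma powr_tangent_bound_normalized:
  fixes r :: real
  assumes r: "r > 1"
  obtains C where "C \<ge> 1"
    and "\<And>u \<eta>. 0 < \<eta> \<Longrightarrow> \<eta> \<le> 1 \<Longrightarrow>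
      \<bar>1 + u\<bar> powr r \<le> 1 + \<eta> + r * u + C * \<eta> powr (1 - max 1 (r / 2)) * \<bar>u\<bar> powr r"
proof -
  obtain A where A: "A \<ge> 1"
    "\<And>u. \<bar>u\<bar> \<le> 1 / 2 \<Longrightarrow> (1 + u) powr r \<le> 1 + r * u + A * u\<^sup>2"
    by (rule powr_quadratic_bound[OF r]) blast
  define C where "C = A powr r + 3 powr r + r * 2 powr r"
  have A_C: "A powr r \<le> C"
    using r by (simp add: C_def)
  have A1: "1 \<le> A powr r"
    using A r by (simp add: ge_one_powr_ge_zero)
  show ?thesis
  proof (rule that)
    show "C \<ge> 1"
      using A1 A_C by simp
    fix u \<eta> :: real
    assume \<eta>: "0 < \<eta>" "\<eta> \<le> 1"
    define c where "c = \<eta> powr (1 - max 1 (r / 2))"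
    have "\<eta> powr 0 \<le> c"
      unfolding c_def using \<eta> by (intro powr_mono') auto
    then have c1: "c \<ge> 1"
      using \<eta> by simp
    show "\<bar>1 + u\<bar> powr r \<le> 1 + \<eta> + r * u + C * \<eta> powr (1 - max 1 (r / 2)) * \<bar>u\<bar> powr r"
      unfolding c_def[symmetric]
    proof (cases "\<bar>u\<bar> \<le> 1 / 2")
      case False
      have "\<bar>1 + u\<bar> powr r \<le> (3 * \<bar>u\<bar>) powr r"
        using False r by (intro powr_mono2) auto
      then have 1: "\<bar>1 + u\<bar> powr r \<le> 3 powr r * \<bar>u\<bar> powr r"
        by (simp add: powr_mult)
      have "(2 * \<bar>u\<bar>) powr 1 \<le> (2 * \<bar>u\<bar>) powr r"
        using False r by (intro powr_mono) auto
      then have "\<bar>u\<bar> \<le> 2 powr r * \<bar>u\<bar> powr r"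
        by (simp add: powr_mult)
      then have "r * \<bar>u\<bar> \<le> r * (2 powr r * \<bar>u\<bar> powr r)"
        using r by (intro mult_left_mono) auto
      moreover have "- (r * u) \<le> r * \<bar>u\<bar>"
        using r by (simp add: abs_if)
      ultimately have "\<bar>1 + u\<bar> powr r - r * u \<le> (3 powr r + r * 2 powr r) * \<bar>u\<bar> powr r"
        using 1 by (simp add: algebra_simps)
      also have "\<dots> \<le> C * \<bar>u\<bar> powr r"
        by (intro mult_right_mono) (auto simp: C_def)
      also have "\<dots> \<le> C * c * \<bar>u\<bar> powr r"
        using c1 \<open>C \<ge> 1\<close> by (intro mult_right_mono) auto
      finally show "\<bar>1 + u\<bar> powr r \<le> 1 + \<eta> + r * u + C * c * \<bar>u\<bar> powr r"
        using \<eta> by simp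
    next
      case True
      have "A * u\<^sup>2 \<le> \<eta> + A powr r * c * \<bar>u\<bar> powr r"
      proof (cases "r \<le> 2 \<or> u = 0")
        case r2: True
        show ?thesis
        proof (cases "u = 0")
          case False
          have "\<bar>u\<bar> powr 2 \<le> \<bar>u\<bar> powr r"
            using True False r2 by (intro powr_mono') auto
          then have "u\<^sup>2 \<le> \<bar>u\<bar> powr r"
            using False by simp
          moreover have "A powr 1 \<le> A powr r"
            using A r by (intro powr_mono) auto
          ultimately have "A * u\<^sup>2 \<le> A powr r * \<bar>u\<bar> powr r"
            using A by (intro mult_mono) auto
          moreover have "c = 1"
            using r2 False \<eta> by (simp add: c_def max_def)
          ultimately show ?thesis
            using \<eta> by simp
        qed (use \<eta> in simp)
      next
        case r2: False
        show ?thesis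
        proof (cases "A * u\<^sup>2 \<le> \<eta>")
          case True
          then show ?thesis
            using c1 by (simp add: add_increasing2)
        next
          case False
          then have "\<eta> / A \<le> u\<^sup>2"
            using A by (simp add: field_simps)
          then have "(u\<^sup>2) powr (1 - r / 2) \<le> (\<eta> / A) powr (1 - r / 2)"
            using r2 A \<eta> by (intro powr_mono2') auto
          also have "\<dots> = c * A powr (r / 2 - 1)"
            using r2 A \<eta> by (simp add: c_def powr_divide powr_diff max_def)
          finally have *: "(u\<^sup>2) powr (1 - r / 2) \<le> c * A powr (r / 2 - 1)" .
          have u2: "u\<^sup>2 = \<bar>u\<bar> powr 2"
            using r2 by simp
          have "u\<^sup>2 = (u\<^sup>2) powr (1 - r / 2) * \<bar>u\<bar> powr r"
            unfolding u2 using r2 by (simp only: powr_powr powr_add[symmetric]) (simp add: algebra_simps)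
          also have "\<dots> \<le> c * A powr (r / 2 - 1) * \<bar>u\<bar> powr r"
            using * by (intro mult_right_mono) auto
          finally have "A * u\<^sup>2 \<le> A * (c * A powr (r / 2 - 1) * \<bar>u\<bar> powr r)"
            using A by (intro mult_left_mono) auto
          also have "\<dots> = A powr (r / 2) * (c * \<bar>u\<bar> powr r)"
            using A by (simp add: powr_diff)
          also have "\<dots> \<le> A powr r * (c * \<bar>u\<bar> powr r)"
            using A r c1 by (intro mult_right_mono powr_mono) auto
          finally show ?thesis
            using \<eta> by (simp add: mult.assoc)
        qed
      qed
      also have "\<dots> \<le> \<eta> + C * c * \<bar>u\<bar> powr r"
        using A_C c1 by (intro add_left_mono mult_right_mono) auto
      finally show "\<bar>1 + u\<bar> powr r \<le> 1 + \<eta> + r * u + C * c * \<bar>u\<bar> powr r"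
        using A(2)[OF True] True by simp
    qed
  qed
qed

text \<open>The tolerance $\eta = 1/(2n)$ is chosen with an induction on the number $n$ of summands in
  view: a factor $1 + 1/(2n)$ on the $r$-th moment at step $n$ is compatible with growth of order
  $n^{\max(1, r/2)}$, with half of the growth left over for the remainder term.\<close>

lemma powr_tangent_bound:
  fixes r :: real
  assumes r: "r > 1"
  obtains C where "C \<ge> 1"
    and "\<And>x y (n :: nat). n \<ge> 1 \<Longrightarrow>
      \<bar>x + y\<bar> powr r \<le> (1 + 1 / (2 * real n)) * \<bar>x\<bar> powr r
        + r * (sgn x * \<bar>x\<bar> powr (r - 1)) * y + C * real n powr (max 1 (r / 2) - 1) * \<bar>y\<bar> powr r"
proof -
  obtain C where C: "C \<ge> 1"
    "\<And>u \<eta>. 0 < \<eta> \<Longrightarrow> \<eta> \<le> 1 \<Longrightarrow>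
      \<bar>1 + u\<bar> powr r \<le> 1 + \<eta> + r * u + C * \<eta> powr (1 - max 1 (r / 2)) * \<bar>u\<bar> powr r"
    by (rule powr_tangent_bound_normalized[OF r]) blast
  define e where "e = max 1 (r / 2)"
  have e: "e \<ge> 1"
    by (simp add: e_def)
  have C2: "1 \<le> C * 2 powr (e - 1)"
    using C e mult_mono[of 1 C 1 "2 powr (e - 1)"] by (simp add: ge_one_powr_ge_zero)
  show ?thesis
  proof (rule that[OF C2[unfolded e_def]], fold e_def)
    fix x y :: real and n :: nat
    assume n: "n \<ge> 1"
    show "\<bar>x + y\<bar> powr r \<le> (1 + 1 / (2 * real n)) * \<bar>x\<bar> powr r
        + r * (sgn x * \<bar>x\<bar> powr (r - 1)) * y + C * 2 powr (e - 1) * real n powr (e - 1) * \<bar>y\<bar> powr r"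
    proof (cases "x = 0")
      case True
      have "1 \<le> C * 2 powr (e - 1) * real n powr (e - 1)"
        using C2 n e mult_mono[of 1 "C * 2 powr (e - 1)" 1 "real n powr (e - 1)"]
        by (simp add: ge_one_powr_ge_zero)
      from mult_right_mono[OF this, of "\<bar>y\<bar> powr r"] show ?thesis
        using True by simp
    next
      case False
      have *: "\<bar>1 + y / x\<bar> powr r \<le> 1 + 1 / (2 * real n) + r * (y / x)
          + C * (1 / (2 * real n)) powr (1 - e) * \<bar>y / x\<bar> powr r"
        unfolding e_def using n by (intro C) auto
      have "(1 / (2 * real n)) powr (1 - e) = 2 powr (e - 1) * real n powr (e - 1)"
        using n by (simp add: powr_divide powr_mult powr_diff)
      note * = *[unfolded this]
      have "\<bar>x + y\<bar> powr r = \<bar>x * (1 + y / x)\<bar> powr r"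
        using False by (simp add: distrib_left)
      also have "\<dots> = \<bar>x\<bar> powr r * \<bar>1 + y / x\<bar> powr r"
        by (simp add: abs_mult powr_mult)
      also have "\<dots> \<le> \<bar>x\<bar> powr r * (1 + 1 / (2 * real n) + r * (y / x)
          + C * (2 powr (e - 1) * real n powr (e - 1)) * \<bar>y / x\<bar> powr r)"
        using * by (intro mult_left_mono) auto
      also have "\<dots> = (1 + 1 / (2 * real n)) * \<bar>x\<bar> powr r + r * (\<bar>x\<bar> powr r / x) * y
          + C * (2 powr (e - 1) * real n powr (e - 1)) * (\<bar>x\<bar> powr r * \<bar>y / x\<bar> powr r)"
        by (simp add: algebra_simps)
      also have "\<bar>x\<bar> powr r / x = sgn x * \<bar>x\<bar> powr (r - 1)"
        using False by (cases "x > 0") (auto simp: powr_diff)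
      also have "\<bar>x\<bar> powr r * \<bar>y / x\<bar> powr r = \<bar>y\<bar> powr r"
        using False by (simp add: powr_mult[symmetric])
      finally show ?thesis
        by (simp add: mult.assoc)
    qed
  qed
qed

section \<open>Absolute moments of sums of independent centred variables\<close>

lemma abs_powr_pred_le:
  fixes r x :: real
  assumes "r > 1"
  shows "\<bar>x\<bar> powr (r - 1) \<le> 1 + \<bar>x\<bar> powr r"
proof (cases "\<bar>x\<bar> \<le> 1")
  case True
  then have "\<bar>x\<bar> powr (r - 1) \<le> 1"
    using assms powr_mono2[of "r - 1" "\<bar>x\<bar>" 1] by simp
  then show ?thesis
    by (simp add: add_increasing2)
next
  case False
  then have "\<bar>x\<bar> powr (r - 1) \<le> \<bar>x\<bar> powr r"
    by (intro powr_mono) auto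
  then show ?thesis
    by simp
qed

lemma powr_bernoulli_step:
  fixes e :: real and n :: nat
  assumes "e \<ge> 1" "n \<ge> 1"
  shows "real n powr e + real n powr (e - 1) \<le> real (Suc n) powr e"
proof -
  have "real n powr e + real n powr (e - 1) = real n powr (e - 1) * real (Suc n)"
    using assms by (simp add: powr_diff field_simps)
  also have "\<dots> \<le> real (Suc n) powr (e - 1) * real (Suc n)"
    using assms by (intro mult_right_mono powr_mono2) auto
  also have "\<dots> = real (Suc n) powr e"
    by (simp add: powr_diff field_simps del: of_nat_Suc)
  finally show ?thesis .
qed

text \<open>This contains the von Bahr--Esseen inequality ($r \le 2$) and the Marcinkiewicz--Zygmund
  inequality for real exponents $r \ge 2$, up to constants. One summand $Y$ is added to the sum $S$
  at a time: in the expansion of $|S + Y|^r$ around $S$ the linear term is a function of $S$ times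
  $Y$, so its expectation vanishes by independence. With $e = \max(1, r/2)$ and the hypothesis
  $E|S|^r \le 2 C B n^e$, the other two terms add up to $2 C B (n^e + n^{e-1})$, which is at most
  $2 C B (n+1)^e$.

  The expansion is a hypothesis so that the constant \<open>C\<close> can be fixed before the probability
  space.\<close>

lemma (in prob_space) moment_sum_bound:
  fixes Y :: "'i \<Rightarrow> 'a \<Rightarrow> real" and r C B :: real
  assumes r: "r > 1" and C: "C \<ge> 1"
    and tangent: "\<And>x y (n :: nat). n \<ge> 1 \<Longrightarrow>
      \<bar>x + y\<bar> powr r \<le> (1 + 1 / (2 * real n)) * \<bar>x\<bar> powr r
        + r * (sgn x * \<bar>x\<bar> powr (r - 1)) * y + C * real n powr (max 1 (r / 2) - 1) * \<bar>y\<bar> powr r"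
    and "finite J" and "indep_vars (\<lambda>_. borel) Y J"
    and "\<And>j. j \<in> J \<Longrightarrow> integrable M (Y j)" and "\<And>j. j \<in> J \<Longrightarrow> expectation (Y j) = 0"
    and "\<And>j. j \<in> J \<Longrightarrow> integrable M (\<lambda>\<omega>. \<bar>Y j \<omega>\<bar> powr r)"
    and "\<And>j. j \<in> J \<Longrightarrow> expectation (\<lambda>\<omega>. \<bar>Y j \<omega>\<bar> powr r) \<le> B"
  shows "integrable M (\<lambda>\<omega>. \<bar>\<Sum>j\<in>J. Y j \<omega>\<bar> powr r) \<and>
    expectation (\<lambda>\<omega>. \<bar>\<Sum>j\<in>J. Y j \<omega>\<bar> powr r) \<le> 2 * C * B * real (card J) powr max 1 (r / 2)"
  using assms(4-)
proof (induction J rule: finite_induct)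
  case empty
  then show ?case by simp
next
  case (insert j J)
  define e where "e = max 1 (r / 2)"
  define S where "S = (\<lambda>\<omega>. \<Sum>i\<in>J. Y i \<omega>)"
  have "indep_vars (\<lambda>_. borel) Y J"
    using insert.prems(1) by (rule indep_vars_subset) auto
  then have S_int: "integrable M (\<lambda>\<omega>. \<bar>S \<omega>\<bar> powr r)"
    and S_le: "expectation (\<lambda>\<omega>. \<bar>S \<omega>\<bar> powr r) \<le> 2 * C * B * real (card J) powr e"
    using insert.IH insert.prems by (auto simp: S_def e_def)
  have Y_int: "integrable M (Y j)" and Y_r: "integrable M (\<lambda>\<omega>. \<bar>Y j \<omega>\<bar> powr r)"
    and Y_0: "expectation (Y j) = 0" and Y_le: "expectation (\<lambda>\<omega>. \<bar>Y j \<omega>\<bar> powr r) \<le> B"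
    using insert.prems by auto
  have "expectation (\<lambda>\<omega>. \<bar>Y j \<omega>\<bar> powr r) \<ge> 0"
    by simp
  with Y_le have B: "B \<ge> 0"
    by linarith
  have sum_eq: "(\<Sum>i\<in>insert j J. Y i \<omega>) = S \<omega> + Y j \<omega>" for \<omega>
    using insert.hyps by (simp add: S_def)
  show ?case
    unfolding sum_eq e_def[symmetric]
  proof (cases "J = {}")
    case True
    \<comment> \<open>The expansion is for \<open>n \<ge> 1\<close>, so the first summand is treated apart.\<close>
    have "B \<le> 2 * C * B"
      using C B mult_right_mono[of 1 "2 * C" B] by simp
    with Y_le True Y_r show "integrable M (\<lambda>\<omega>. \<bar>S \<omega> + Y j \<omega>\<bar> powr r) \<and>
      expectation (\<lambda>\<omega>. \<bar>S \<omega> + Y j \<omega>\<bar> powr r) \<le> 2 * C * B * real (card (insert j J)) powr e"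
      by (simp add: S_def)
  next
    case False
    define n where "n = card J"
    have n: "n \<ge> 1"
      using False insert.hyps by (simp add: n_def Suc_le_eq card_gt_0_iff)
    define T where "T = (\<lambda>\<omega>. sgn (S \<omega>) * \<bar>S \<omega>\<bar> powr (r - 1))"
    have indep: "indep_var borel (Y j) borel S"
      unfolding S_def by (rule indep_vars_sum) (use insert in auto)
    note [measurable] = indep_var_rv1[OF indep] indep_var_rv2[OF indep]
    have T_int: "integrable M T"
    proof (rule Bochner_Integration.integrable_bound)
      show "integrable M (\<lambda>\<omega>. 1 + \<bar>S \<omega>\<bar> powr r)"
        using S_int by simp
      show "AE \<omega> in M. norm (T \<omega>) \<le> norm (1 + \<bar>S \<omega>\<bar> powr r)"
        using abs_powr_pred_le[OF r] by (auto simp: T_def abs_mult abs_sgn_eq)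
    qed (simp add: T_def)
    have "indep_var borel (id \<circ> Y j) borel ((\<lambda>x. sgn x * \<bar>x\<bar> powr (r - 1)) \<circ> S)"
      using indep by (rule indep_var_compose) simp_all
    then have indep_T: "indep_var borel (Y j) borel T"
      by (simp add: T_def comp_def)
    have TY_int: "integrable M (\<lambda>\<omega>. Y j \<omega> * T \<omega>)"
      by (rule indep_var_integrable[OF indep_T Y_int T_int])
    have TY_0: "expectation (\<lambda>\<omega>. Y j \<omega> * T \<omega>) = 0"
      using indep_var_lebesgue_integral[OF indep_T Y_int T_int] Y_0 by simp
    define R where "R = (\<lambda>\<omega>. (1 + 1 / (2 * real n)) * \<bar>S \<omega>\<bar> powr r + r * (Y j \<omega> * T \<omega>)
      + C * real n powr (e - 1) * \<bar>Y j \<omega>\<bar> powr r)"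
    have R_int: "integrable M R"
      unfolding R_def using S_int TY_int Y_r by auto
    have le_R: "\<bar>S \<omega> + Y j \<omega>\<bar> powr r \<le> R \<omega>" for \<omega>
      using tangent[OF n, of "S \<omega>" "Y j \<omega>"] by (simp add: R_def T_def e_def mult_ac)
    have int: "integrable M (\<lambda>\<omega>. \<bar>S \<omega> + Y j \<omega>\<bar> powr r)"
    proof (rule Bochner_Integration.integrable_bound[OF R_int])
      show "AE \<omega> in M. norm (\<bar>S \<omega> + Y j \<omega>\<bar> powr r) \<le> norm (R \<omega>)"
        using le_R by (intro AE_I2) (simp add: order_trans[OF _ abs_ge_self])
    qed simp
    have "expectation (\<lambda>\<omega>. \<bar>S \<omega> + Y j \<omega>\<bar> powr r) \<le> expectation R"
      using int R_int le_R by (rule integral_mono)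
    also have "expectation R = (1 + 1 / (2 * real n)) * expectation (\<lambda>\<omega>. \<bar>S \<omega>\<bar> powr r)
        + C * real n powr (e - 1) * expectation (\<lambda>\<omega>. \<bar>Y j \<omega>\<bar> powr r)"
      unfolding R_def using S_int TY_int Y_r TY_0 by simp
    also have "\<dots> \<le> (1 + 1 / (2 * real n)) * (2 * C * B * real n powr e)
        + C * real n powr (e - 1) * B"
      using S_le Y_le C unfolding n_def[symmetric] by (intro add_mono mult_left_mono) auto
    also have "\<dots> = 2 * C * B * (real n powr e + real n powr (e - 1))"
      using n by (simp add: powr_diff field_simps)
    also have "\<dots> \<le> 2 * C * B * real (Suc n) powr e"
      using powr_bernoulli_step[of e n] n C B by (intro mult_left_mono) (auto simp: e_def)
    also have "Suc n = card (insert j J)"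
      using insert.hyps by (simp add: n_def)
    finally show "integrable M (\<lambda>\<omega>. \<bar>S \<omega> + Y j \<omega>\<bar> powr r) \<and>
      expectation (\<lambda>\<omega>. \<bar>S \<omega> + Y j \<omega>\<bar> powr r) \<le> 2 * C * B * real (card (insert j J)) powr e"
      using int by simp
  qed
qed

section \<open>Conditional probabilities of events that depend on independent data\<close>

text \<open>The freezing lemma: if $\Phi$ is independent of $H$, then conditionally on $H$ every
  $H$-measurable argument may be treated as a constant. Independence makes the law of
  $(\omega, \Phi(\omega))$ on $H \otimes S$ a product measure, and by Fubini the section
  probabilities, which are $H$-measurable, have the integrals over sets of $H$ that characterise the
  conditional expectation. Independence is stated for sigma-algebras since $\omega$ and
  $\Phi(\omega)$ have different types.\<close>

lemma (in prob_space) real_cond_exp_indicator_freeze: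
  fixes \<Phi> :: "'a \<Rightarrow> 'b" and S :: "'b measure"
  assumes sub: "subalgebra M H"
    and \<Phi>: "random_variable S \<Phi>"
    and indep: "indep_set (sets H) {\<Phi> -` B \<inter> space M | B. B \<in> sets S}"
    and E: "E \<in> sets (H \<Otimes>\<^sub>M S)"
  shows "AE \<omega> in M. real_cond_exp M H (indicator {\<omega> \<in> space M. (\<omega>, \<Phi> \<omega>) \<in> E}) \<omega>
    = prob {\<omega>' \<in> space M. (\<omega>, \<Phi> \<omega>') \<in> E}"
proof -
  interpret finite_measure_subalgebra M H
    by unfold_locales (rule sub)
  have sp: "space H = space M"
    using sub by (simp add: subalgebra_def)
  have id_meas: "(\<lambda>\<omega>. \<omega>) \<in> M \<rightarrow>\<^sub>M H"
    by (rule measurable_from_subalg[OF sub]) simp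
  note [measurable] = E \<Phi> id_meas
  define \<mu> where "\<mu> = distr M S \<Phi>"
  define \<nu> where "\<nu> = distr M H (\<lambda>\<omega>. \<omega>)"
  interpret \<mu>: prob_space \<mu>
    unfolding \<mu>_def by (rule prob_space_distr) simp
  interpret \<nu>: prob_space \<nu>
    unfolding \<nu>_def by (rule prob_space_distr) simp
  have joint: "\<nu> \<Otimes>\<^sub>M \<mu> = distr M (H \<Otimes>\<^sub>M S) (\<lambda>\<omega>. (\<omega>, \<Phi> \<omega>))"
  proof (rule pair_measure_eqI)
    fix A B
    assume "A \<in> sets \<nu>" "B \<in> sets \<mu>"
    then have A: "A \<in> sets H" and B: "B \<in> sets S"
      by (simp_all add: \<nu>_def \<mu>_def)
    have A': "A \<inter> space M = A"
      using sets.sets_into_space[OF A] sp by auto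
    have "(\<lambda>\<omega>. (\<omega>, \<Phi> \<omega>)) -` (A \<times> B) \<inter> space M = A \<inter> (\<Phi> -` B \<inter> space M)"
      by auto
    then have "emeasure (distr M (H \<Otimes>\<^sub>M S) (\<lambda>\<omega>. (\<omega>, \<Phi> \<omega>))) (A \<times> B)
        = ennreal (prob (A \<inter> (\<Phi> -` B \<inter> space M)))"
      using A B by (simp add: emeasure_distr emeasure_eq_measure)
    also have "prob (A \<inter> (\<Phi> -` B \<inter> space M)) = prob A * prob (\<Phi> -` B \<inter> space M)"
      using A B by (intro indep_setD[OF indep]) auto
    also have "ennreal \<dots> = emeasure \<nu> A * emeasure \<mu> B"
      using A B A' by (simp add: \<nu>_def \<mu>_def emeasure_distr emeasure_eq_measure ennreal_mult)
    finally show "emeasure \<nu> A * emeasure \<mu> B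
      = emeasure (distr M (H \<Otimes>\<^sub>M S) (\<lambda>\<omega>. (\<omega>, \<Phi> \<omega>))) (A \<times> B)" by simp
  qed (auto simp: \<nu>_def \<mu>_def \<nu>.sigma_finite_measure_axioms[unfolded \<nu>_def]
      \<mu>.sigma_finite_measure_axioms[unfolded \<mu>_def] intro!: sets_pair_measure_cong)
  have sets_pair: "sets (\<nu> \<Otimes>\<^sub>M \<mu>) = sets (H \<Otimes>\<^sub>M S)"
    by (intro sets_pair_measure_cong) (simp_all add: \<mu>_def \<nu>_def)
  define g where "g = (\<lambda>\<omega>. measure \<mu> (Pair \<omega> -` E))"
  have g_eq: "g \<omega> = prob {\<omega>' \<in> space M. (\<omega>, \<Phi> \<omega>') \<in> E}" for \<omega>
  proof -
    have "Pair \<omega> -` E \<in> sets S"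
      using E by (rule sets_Pair1)
    then show ?thesis
      unfolding g_def \<mu>_def by (subst measure_distr) (auto intro!: arg_cong[where f = prob])
  qed
  have [measurable]: "g \<in> borel_measurable H"
  proof -
    have "(\<lambda>\<omega>. emeasure \<mu> (Pair \<omega> -` E)) \<in> borel_measurable \<nu>"
      by (rule \<mu>.measurable_emeasure_Pair) (simp add: sets_pair E)
    then show ?thesis
      unfolding g_def measure_def by (simp add: \<nu>_def)
  qed
  have gM: "g \<in> borel_measurable M"
    by (rule measurable_from_subalg[OF sub]) simp
  let ?Ev = "{\<omega> \<in> space M. (\<omega>, \<Phi> \<omega>) \<in> E}"
  have Ev: "?Ev \<in> sets M"
  proof -
    have "(\<lambda>\<omega>. (\<omega>, \<Phi> \<omega>)) -` E \<inter> space M \<in> sets M"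
      by (rule measurable_sets[OF _ E]) simp
    then show ?thesis
      by (simp add: vimage_def Collect_conj_eq Int_commute)
  qed
  have "AE \<omega> in M. real_cond_exp M H (indicator ?Ev) \<omega> = g \<omega>"
  proof (rule real_cond_exp_charact)
    fix A
    assume A: "A \<in> sets H"
    have AM: "A \<in> sets M"
      using A sub by (auto simp: subalgebra_def)
    have AE_in: "A \<times> space S \<inter> E \<in> sets (H \<Otimes>\<^sub>M S)"
      using A E by auto
    have "ennreal (prob (A \<inter> ?Ev)) = emeasure (\<nu> \<Otimes>\<^sub>M \<mu>) (A \<times> space S \<inter> E)"
      unfolding joint
    proof (subst emeasure_distr)
      have "A \<inter> ?Ev = (\<lambda>\<omega>. (\<omega>, \<Phi> \<omega>)) -` (A \<times> space S \<inter> E) \<inter> space M"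
        using measurable_space[OF \<Phi>] by auto
      then show "ennreal (prob (A \<inter> ?Ev))
        = emeasure M ((\<lambda>\<omega>. (\<omega>, \<Phi> \<omega>)) -` (A \<times> space S \<inter> E) \<inter> space M)"
        by (simp add: emeasure_eq_measure)
    qed (use AE_in in simp_all)
    also have "\<dots> = (\<integral>\<^sup>+ \<omega>. emeasure \<mu> (Pair \<omega> -` (A \<times> space S \<inter> E)) \<partial>\<nu>)"
      by (rule \<mu>.emeasure_pair_measure_alt) (simp add: sets_pair AE_in)
    also have "\<dots> = (\<integral>\<^sup>+ \<omega>. ennreal (indicator A \<omega> * g \<omega>) \<partial>\<nu>)"
    proof (rule nn_integral_cong)
      fix \<omega>
      have "E \<subseteq> space H \<times> space S"
        using sets.sets_into_space[OF E] by (simp add: space_pair_measure)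
      then have "Pair \<omega> -` (A \<times> space S \<inter> E) = (if \<omega> \<in> A then Pair \<omega> -` E else {})"
        by auto
      then show "emeasure \<mu> (Pair \<omega> -` (A \<times> space S \<inter> E)) = ennreal (indicator A \<omega> * g \<omega>)"
        by (simp add: g_def \<mu>.emeasure_eq_measure)
    qed
    also have "\<dots> = (\<integral>\<^sup>+ \<omega>. ennreal (indicator A \<omega> * g \<omega>) \<partial>M)"
      unfolding \<nu>_def using A by (subst nn_integral_distr) simp_all
    also have "\<dots> = ennreal (\<integral>\<omega>. indicator A \<omega> * g \<omega> \<partial>M)"
    proof (rule nn_integral_eq_integral)
      show "integrable M (\<lambda>\<omega>. indicator A \<omega> * g \<omega>)"
        using AM gM by (intro integrable_const_bound[where B = 1])
          (auto simp: g_def \<mu>.prob_le_1 split: split_indicator)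
    qed (simp add: g_def)
    finally have *: "prob (A \<inter> ?Ev) = (\<integral>\<omega>. indicator A \<omega> * g \<omega> \<partial>M)"
      by (simp add: g_def integral_nonneg_AE)
    have "(\<integral>\<omega>\<in>A. indicator ?Ev \<omega> \<partial>M) = (\<integral>\<omega>. indicator (A \<inter> ?Ev) \<omega> \<partial>M)"
      unfolding set_lebesgue_integral_def
      by (intro Bochner_Integration.integral_cong) (auto split: split_indicator)
    also have "\<dots> = prob (A \<inter> ?Ev)"
      using AM Ev by (simp add: Int_absorb2 sets.sets_into_space sets.Int)
    also have "\<dots> = (\<integral>\<omega>\<in>A. g \<omega> \<partial>M)"
      unfolding * by (simp add: set_lebesgue_integral_def)
    finally show "(\<integral>\<omega>\<in>A. indicator ?Ev \<omega> \<partial>M) = (\<integral>\<omega>\<in>A. g \<omega> \<partial>M)" .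
  next
    show "integrable M (indicator ?Ev :: _ \<Rightarrow> real)"
      using Ev by (intro integrable_real_indicator) (simp_all add: emeasure_eq_measure)
    show "integrable M g"
      using gM by (intro integrable_const_bound[where B = 1]) (auto simp: g_def \<mu>.prob_le_1)
  qed simp
  then show ?thesis
    by (simp add: g_eq)
qed

section \<open>Measurability with respect to the history\<close>

lemma sets_history:
  "sets (history M G Fe Fg k) = sigma_sets (space M)
     ({Fe j -` B \<inter> space M | j B. j < k \<and> B \<in> sets borel}
    \<union> {Fg j -` B \<inter> space M | j B. j < k \<and> B \<in> sets borel}
    \<union> {G j -` B \<inter> space M | j B. j \<le> k \<and> B \<in> sets borel})"
  unfolding history_def by (rule sets_measure_of) auto

lemma space_history [simp]: "space (history M G Fe Fg k) = space M"
  unfolding history_def by (rule space_measure_of) auto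

lemma direction_measurable_history:
  fixes G :: "nat \<Rightarrow> 'w \<Rightarrow> real ^ 'n"
  assumes "j \<le> k"
  shows "G j \<in> borel_measurable (history M G Fe Fg k)"
proof (rule measurableI)
  fix B :: "(real ^ 'n) set"
  assume "B \<in> sets borel"
  then show "G j -` B \<inter> space (history M G Fe Fg k) \<in> sets (history M G Fe Fg k)"
    unfolding sets_history space_history using assms
    by (intro sigma_sets.Basic UnI2 CollectI exI[of _ j] exI[of _ B]) simp
qed simp

lemma estimates_measurable_history:
  assumes "j < k"
  shows "Fe j \<in> borel_measurable (history M G Fe Fg k)"
    and "Fg j \<in> borel_measurable (history M G Fe Fg k)"
proof -
  have "Fe j -` B \<inter> space M \<in> sets (history M G Fe Fg k)" if "B \<in> sets borel" for B
    unfolding sets_history using assms that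
    by (intro sigma_sets.Basic, intro UnI1 CollectI exI[of _ j] exI[of _ B]) simp
  moreover have "Fg j -` B \<inter> space M \<in> sets (history M G Fe Fg k)" if "B \<in> sets borel" for B
    unfolding sets_history using assms that
    by (intro sigma_sets.Basic, intro UnI1[OF UnI2] CollectI exI[of _ j] exI[of _ B]) simp
  ultimately show "Fe j \<in> borel_measurable (history M G Fe Fg k)"
    and "Fg j \<in> borel_measurable (history M G Fe Fg k)"
    by (simp_all add: measurable_def)
qed

context stochastic_dfo
begin

lemma subalgebra_history: "subalgebra M (history M G Fe Fg k)"
  unfolding subalgebra_def sets_history
  using measurable_sets[OF Fe_measurable] measurable_sets[OF Fg_measurable]
    measurable_sets[OF G_measurable]
  by (auto intro!: sets.sigma_sets_subset)

lemma iterate_stepsize_measurable_history: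
  assumes "k \<le> m"
  shows "X k \<in> borel_measurable (history M G Fe Fg m)"
    and "D k \<in> borel_measurable (history M G Fe Fg m)"
proof -
  let ?H = "history M G Fe Fg m"
  have "X k \<in> borel_measurable ?H \<and> D k \<in> borel_measurable ?H"
    using assms
  proof (induction k)
    case 0
    obtain x0 d0 where "\<forall>\<omega>\<in>space M. X 0 \<omega> = x0" "\<forall>\<omega>\<in>space M. D 0 \<omega> = d0"
      using X_0_deterministic D_0_deterministic by blast
    then have "X 0 \<in> borel_measurable ?H \<longleftrightarrow> (\<lambda>_. x0) \<in> borel_measurable ?H"
      and "D 0 \<in> borel_measurable ?H \<longleftrightarrow> (\<lambda>_. d0) \<in> borel_measurable ?H"
      by (intro measurable_cong; simp)+
    then show ?case
      by simp
  next
    case (Suc k)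
    have "(\<lambda>\<omega>. (X k \<omega>, D k \<omega>, G k \<omega>, Fe k \<omega>, Fg k \<omega>)) \<in> borel_measurable ?H"
      using Suc by (intro borel_measurable_Pair direction_measurable_history
          estimates_measurable_history) auto
    then have "(\<lambda>\<omega>. U k (X k \<omega>, D k \<omega>, G k \<omega>, Fe k \<omega>, Fg k \<omega>)) \<in> ?H \<rightarrow>\<^sub>M borel \<Otimes>\<^sub>M borel"
      unfolding borel_prod by (rule measurable_compose[OF _ U_measurable])
    then have "(\<lambda>\<omega>. (X (Suc k) \<omega>, D (Suc k) \<omega>)) \<in> ?H \<rightarrow>\<^sub>M borel \<Otimes>\<^sub>M borel"
      by (rule measurable_cong[THEN iffD1, rotated]) (simp add: update)
    from measurable_compose[OF this measurable_fst] measurable_compose[OF this measurable_snd]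
    show ?case
      by simp
  qed
  then show "X k \<in> borel_measurable ?H" and "D k \<in> borel_measurable ?H"
    by auto
qed

end

section \<open>Sample averages at fixed points\<close>

text \<open>The two averages are handled together: $n$ times the deviation is one sum of $2n$ independent
  centred variables, namely $F(x, \xi_i) - f(x)$ and $-(F(y, \xi^g_i) - f(y))$. Its $r$-th absolute
  moment is bounded by the preceding section, and Markov's inequality for that moment gives the
  tail.\<close>

lemma (in prob_space) sample_average_difference_tail:
  fixes Z :: "nat + nat \<Rightarrow> 'a \<Rightarrow> 's" and F :: "'x \<Rightarrow> 's \<Rightarrow> real" and f :: "'x \<Rightarrow> real"
    and r C B t :: real and n :: nat
  assumes r: "r > 1" and C: "C \<ge> 1"
    and tangent: "\<And>x y (n :: nat). n \<ge> 1 \<Longrightarrow>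
      \<bar>x + y\<bar> powr r \<le> (1 + 1 / (2 * real n)) * \<bar>x\<bar> powr r
        + r * (sgn x * \<bar>x\<bar> powr (r - 1)) * y + C * real n powr (max 1 (r / 2) - 1) * \<bar>y\<bar> powr r"
    and indep: "indep_vars (\<lambda>_. N) Z ({1..} <+> {1..})"
    and law: "\<And>j. j \<in> {1..} <+> {1..} \<Longrightarrow> distr M N (Z j) = Xi"
    and F_meas: "\<And>x. F x \<in> borel_measurable N"
    and F_int: "\<And>x. integrable Xi (F x)" and mean: "\<And>x. (\<integral>z. F x z \<partial>Xi) = f x"
    and r_int: "\<And>x. integrable Xi (\<lambda>z. \<bar>F x z - f x\<bar> powr r)"
    and r_le: "\<And>x. (\<integral>z. \<bar>F x z - f x\<bar> powr r \<partial>Xi) \<le> B"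
    and n: "n \<ge> 1" and t: "t > 0"
  shows "prob {\<omega> \<in> space M.
      \<bar>(\<Sum>i = 1..n. F x (Z (Inl i) \<omega>)) / real n - (\<Sum>i = 1..n. F y (Z (Inr i) \<omega>)) / real n
        - (f x - f y)\<bar> \<ge> t}
    \<le> 2 * C * B * (2 * real n) powr max 1 (r / 2) / (real n * t) powr r"
proof -
  define J where "J = {1..n} <+> {1..n}"
  have J: "finite J" "J \<subseteq> {1..} <+> {1..}" "card J = 2 * n"
    by (auto simp: J_def card_Plus)
  define a where "a = (\<lambda>j :: nat + nat. case j of Inl _ \<Rightarrow> x | Inr _ \<Rightarrow> y)"
  define \<sigma> :: "nat + nat \<Rightarrow> real" where "\<sigma> = (\<lambda>j. case j of Inl _ \<Rightarrow> 1 | Inr _ \<Rightarrow> - 1)"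
  have \<sigma>: "\<bar>\<sigma> j\<bar> = 1" for j
    by (simp add: \<sigma>_def split: sum.split)
  define h where "h = (\<lambda>j z. \<sigma> j * (F (a j) z - f (a j)))"
  define Y where "Y = (\<lambda>j \<omega>. h j (Z j \<omega>))"
  have h_meas [measurable]: "h j \<in> borel_measurable N" for j
    unfolding h_def
    by (intro borel_measurable_times borel_measurable_diff borel_measurable_const F_meas)
  have Z_meas: "random_variable N (Z j)" if "j \<in> J" for j
    using indep J that by (auto simp: indep_vars_def)
  have law_J: "distr M N (Z j) = Xi" if "j \<in> J" for j
    using law J that by blast
  have transfer: "integrable M (\<lambda>\<omega>. \<phi> (Z j \<omega>)) \<longleftrightarrow> integrable Xi \<phi>"
      "expectation (\<lambda>\<omega>. \<phi> (Z j \<omega>)) = (\<integral>z. \<phi> z \<partial>Xi)"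
    if "j \<in> J" "\<phi> \<in> borel_measurable N" for j and \<phi> :: "'s \<Rightarrow> real"
    by (rule integrable_distr_eq[OF Z_meas[OF that(1)] that(2), symmetric, unfolded law_J[OF that(1)]])
      (rule integral_distr[OF Z_meas[OF that(1)] that(2), symmetric, unfolded law_J[OF that(1)]])
  have Y_indep: "indep_vars (\<lambda>_. borel) Y J"
    unfolding Y_def using indep_vars_subset[OF indep J(2)] by (rule indep_vars_compose2) simp
  have "integrable M (\<lambda>\<omega>. \<bar>\<Sum>j\<in>J. Y j \<omega>\<bar> powr r) \<and>
    expectation (\<lambda>\<omega>. \<bar>\<Sum>j\<in>J. Y j \<omega>\<bar> powr r) \<le> 2 * C * B * real (card J) powr max 1 (r / 2)"
  proof (rule moment_sum_bound[OF r C tangent \<open>finite J\<close> Y_indep])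
    fix j assume j: "j \<in> J"
    have "integrable Xi (h j)" and "(\<integral>z. h j z \<partial>Xi) = 0"
    proof -
      interpret Xi: prob_space Xi
        using prob_space_distr[OF Z_meas[OF j]] law_J[OF j] by simp
      show "integrable Xi (h j)" and "(\<integral>z. h j z \<partial>Xi) = 0"
        using F_int mean by (simp_all add: h_def Xi.prob_space)
    qed
    then show "integrable M (Y j)" "expectation (Y j) = 0"
      unfolding Y_def using transfer[OF j h_meas] by simp_all
    have abs_h: "\<bar>h j z\<bar> = \<bar>F (a j) z - f (a j)\<bar>" for z
      by (simp add: h_def abs_mult \<sigma>)
    have "(\<lambda>z. \<bar>h j z\<bar> powr r) \<in> borel_measurable N"
      by measurable
    from transfer[OF j this] show "integrable M (\<lambda>\<omega>. \<bar>Y j \<omega>\<bar> powr r)"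
        "expectation (\<lambda>\<omega>. \<bar>Y j \<omega>\<bar> powr r) \<le> B"
      using r_int[of "a j"] r_le[of "a j"] by (simp_all add: Y_def abs_h)
  qed
  then have S_int: "integrable M (\<lambda>\<omega>. \<bar>\<Sum>j\<in>J. Y j \<omega>\<bar> powr r)"
    and S_le: "expectation (\<lambda>\<omega>. \<bar>\<Sum>j\<in>J. Y j \<omega>\<bar> powr r)
      \<le> 2 * C * B * (2 * real n) powr max 1 (r / 2)"
    using J(3) by simp_all
  have sum_Y: "(\<Sum>j\<in>J. Y j \<omega>) = real n * ((\<Sum>i = 1..n. F x (Z (Inl i) \<omega>)) / real n
      - (\<Sum>i = 1..n. F y (Z (Inr i) \<omega>)) / real n - (f x - f y))" for \<omega>
  proof -
    have "(\<Sum>j\<in>J. Y j \<omega>) = (\<Sum>i = 1..n. Y (Inl i) \<omega>) + (\<Sum>i = 1..n. Y (Inr i) \<omega>)"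
      unfolding J_def by (subst sum.Plus) simp_all
    moreover have "(\<Sum>i = 1..n. Y (Inl i) \<omega>) = (\<Sum>i = 1..n. F x (Z (Inl i) \<omega>)) - real n * f x"
      by (simp add: Y_def h_def a_def \<sigma>_def sum_subtractf)
    moreover have "(\<Sum>i = 1..n. Y (Inr i) \<omega>) = real n * f y - (\<Sum>i = 1..n. F y (Z (Inr i) \<omega>))"
      by (simp add: Y_def h_def a_def \<sigma>_def sum_subtractf)
    ultimately show ?thesis
      using n by (simp add: right_diff_distrib)
  qed
  have nt: "real n * t > 0"
    using n t by simp
  have event_eq: "{\<omega> \<in> space M.
      \<bar>(\<Sum>i = 1..n. F x (Z (Inl i) \<omega>)) / real n - (\<Sum>i = 1..n. F y (Z (Inr i) \<omega>)) / real n
        - (f x - f y)\<bar> \<ge> t}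
    = {\<omega> \<in> space M. \<bar>\<Sum>j\<in>J. Y j \<omega>\<bar> powr r \<ge> (real n * t) powr r}"
  proof -
    have "t \<le> \<bar>d\<bar> \<longleftrightarrow> (real n * t) powr r \<le> \<bar>real n * d\<bar> powr r" for d
    proof -
      have "t \<le> \<bar>d\<bar> \<longleftrightarrow> real n * t \<le> \<bar>real n * d\<bar>"
        using n by (simp add: abs_mult)
      also have "\<dots> \<longleftrightarrow> (real n * t) powr r \<le> \<bar>real n * d\<bar> powr r"
      proof
        assume "real n * t \<le> \<bar>real n * d\<bar>"
        then show "(real n * t) powr r \<le> \<bar>real n * d\<bar> powr r"
          using nt r by (intro powr_mono2) auto
      next
        assume le: "(real n * t) powr r \<le> \<bar>real n * d\<bar> powr r"
        show "real n * t \<le> \<bar>real n * d\<bar>"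
        proof (rule ccontr)
          assume "\<not> real n * t \<le> \<bar>real n * d\<bar>"
          then have "\<bar>real n * d\<bar> powr r < (real n * t) powr r"
            using r by (intro powr_less_mono2) auto
          with le show False by simp
        qed
      qed
      finally show ?thesis .
    qed
    then show ?thesis
      unfolding sum_Y by (intro Collect_cong conj_cong refl)
  qed
  show ?thesis
    unfolding event_eq
  proof (rule order_trans)
    show "prob {\<omega> \<in> space M. \<bar>\<Sum>j\<in>J. Y j \<omega>\<bar> powr r \<ge> (real n * t) powr r}
      \<le> expectation (\<lambda>\<omega>. \<bar>\<Sum>j\<in>J. Y j \<omega>\<bar> powr r) / (real n * t) powr r"
      using nt n t by (intro integral_Markov_inequality_measure[OF S_int, of "{}"]) simp_all
    show "expectation (\<lambda>\<omega>. \<bar>\<Sum>j\<in>J. Y j \<omega>\<bar> powr r) / (real n * t) powr r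
      \<le> 2 * C * B * (2 * real n) powr max 1 (r / 2) / (real n * t) powr r"
      using S_le by (rule divide_right_mono) simp
  qed
qed

section \<open>The sample size and the tail bound condition\<close>

lemma ceiling_powr_sample_size:
  fixes s :: real and p :: "real \<Rightarrow> nat"
  assumes "s > 0" and p_def: "p = (\<lambda>\<delta>. nat \<lceil>\<delta> powr (- s)\<rceil>)"
  shows "\<delta> powr (- s) \<le> real (p \<delta>)" and "\<delta> > 0 \<Longrightarrow> p \<delta> \<ge> 1"
    and "(\<lambda>\<delta>. real (p \<delta>)) \<in> O[at_right 0](\<lambda>\<delta>. \<delta> powr (- s))"
    and "p \<in> borel \<rightarrow>\<^sub>M count_space UNIV"
proof -
  show "\<delta> powr (- s) \<le> real (p \<delta>)"
    unfolding p_def by (rule real_nat_ceiling_ge)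
  show "p \<delta> \<ge> 1" if "\<delta> > 0"
  proof -
    have "0 < \<delta> powr (- s)"
      using that by simp
    then have "0 < \<lceil>\<delta> powr (- s)\<rceil>"
      by linarith
    then show ?thesis
      unfolding p_def by linarith
  qed
  show "(\<lambda>\<delta>. real (p \<delta>)) \<in> O[at_right 0](\<lambda>\<delta>. \<delta> powr (- s))"
  proof (rule bigoI[where c = 2])
    have "\<forall>\<^sub>F \<delta> in at_right 0. (0 :: real) < \<delta> \<and> \<delta> < 1"
      by (auto simp: eventually_at_right_less eventually_at_right_field intro!: exI[of _ 1])
    then show "\<forall>\<^sub>F \<delta> in at_right 0. norm (real (p \<delta>)) \<le> 2 * norm (\<delta> powr (- s))"
    proof eventually_elim
      case (elim \<delta>)
      have "1 powr (- s) \<le> \<delta> powr (- s)"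
        using elim assms by (intro powr_mono2') auto
      moreover have "real (p \<delta>) \<le> \<delta> powr (- s) + 1"
        unfolding p_def by (simp add: of_nat_ceiling)
      ultimately show ?case
        by simp
    qed
  qed
  show "p \<in> borel \<rightarrow>\<^sub>M count_space UNIV"
    unfolding p_def by measurable
qed

text \<open>The balance that determines $s$: Markov's inequality leaves the factor
  $n^{e-r} \delta^{-qr}$, and it is bounded as soon as $n \ge \delta^{-s}$ with $s (r - e) = q r$.\<close>

lemma sample_size_exponent_cancels:
  fixes n \<delta> \<alpha> q r e s :: real
  assumes "\<delta> > 0" "\<alpha> > 0" "e < r" and s: "s * (r - e) = q * r" and n: "\<delta> powr (- s) \<le> n"
  shows "(2 * n) powr e / (n * (\<alpha> * \<delta> powr q)) powr r \<le> 2 powr e / \<alpha> powr r"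
proof -
  have pos: "0 < \<delta> powr (- s)"
    using assms by simp
  with n have "n > 0"
    by linarith
  have "n powr (e - r) \<le> (\<delta> powr (- s)) powr (e - r)"
    using pos n assms by (intro powr_mono2') auto
  also have "\<dots> = \<delta> powr (q * r)"
    using s by (simp add: powr_powr algebra_simps)
  finally have le: "n powr (e - r) \<le> \<delta> powr (q * r)" .
  have "(2 * n) powr e / (n * (\<alpha> * \<delta> powr q)) powr r
      = 2 powr e / \<alpha> powr r * (n powr (e - r) / \<delta> powr (q * r))"
    using assms \<open>n > 0\<close> by (simp add: powr_mult powr_powr powr_diff)
  also have "\<dots> \<le> 2 powr e / \<alpha> powr r * 1"
    using le assms by (intro mult_left_mono) auto
  finally show ?thesis
    by simp
qed

text \<open>The iterate, the stepsize and the direction are measurable with respect to the history, while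
  the samples are independent of it. By the freezing lemma a bound that holds uniformly over
  deterministic points $x$, $y$ and stepsizes $\delta$ is therefore a bound on the conditional
  probability. The random sample size is covered too, since it is frozen with the stepsize; it
  can be arbitrarily large, so $\Phi$ carries the whole infinite family of samples.\<close>

lemma (in stochastic_dfo) tail_bound_from_frozen_bound:
  fixes Xi N :: "'s measure" and F :: "real ^ 'n \<Rightarrow> 's \<Rightarrow> real" and f :: "real ^ 'n \<Rightarrow> real"
    and p :: "real \<Rightarrow> nat" and q \<epsilon> :: real
  assumes F [measurable]: "case_prod F \<in> borel_measurable (borel \<Otimes>\<^sub>M N)"
    and f [measurable]: "f \<in> borel_measurable borel"
    and p [measurable]: "p \<in> borel \<rightarrow>\<^sub>M count_space UNIV"
    and samples: "sample_average_estimates M N Xi F p X D G Fe Fg"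
    and frozen: "\<And>Z x y \<delta> \<alpha>. indep_vars (\<lambda>_. N) Z ({1..} <+> {1..}) \<Longrightarrow>
      (\<And>j. j \<in> {1..} <+> {1..} \<Longrightarrow> distr M N (Z j) = Xi) \<Longrightarrow> \<delta> > 0 \<Longrightarrow> \<alpha> > 0 \<Longrightarrow>
      prob {\<omega> \<in> space M. \<bar>(\<Sum>i = 1..p \<delta>. F x (Z (Inl i) \<omega>)) / real (p \<delta>)
        - (\<Sum>i = 1..p \<delta>. F y (Z (Inr i) \<omega>)) / real (p \<delta>) - (f x - f y)\<bar> \<ge> \<alpha> * \<delta> powr q}
      \<le> \<epsilon> / \<alpha> powr (q / (q - 1))"
  shows "tail_bound_condition M f q \<epsilon> X D G Fe Fg"
  unfolding tail_bound_condition_def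
proof (intro allI impI)
  fix k :: nat and \<alpha> :: real
  assume \<alpha>: "\<alpha> > 0"
  define H where "H = history M G Fe Fg k"
  have sub: "subalgebra M H"
    unfolding H_def by (rule subalgebra_history)
  have sp: "space H = space M"
    by (simp add: H_def)
  obtain xis xigs :: "nat \<Rightarrow> nat \<Rightarrow> 'w \<Rightarrow> 's" where
    iv: "indep_vars (\<lambda>_. N) (case_sum (xis k) (xigs k)) ({1..} <+> {1..})" and
    law: "\<forall>i\<ge>1. distr M N (xis k i) = Xi \<and> distr M N (xigs k i) = Xi" and
    indep: "indep_set (sets H) (sigma_sets (space M)
      ({xis k i -` A \<inter> space M | i A. i \<ge> 1 \<and> A \<in> sets N}
       \<union> {xigs k i -` A \<inter> space M | i A. i \<ge> 1 \<and> A \<in> sets N}))" and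
    est: "\<And>\<omega>. \<omega> \<in> space M \<Longrightarrow>
      Fe k \<omega> = (\<Sum>i = 1..p (D k \<omega>). F (X k \<omega>) (xis k i \<omega>)) / real (p (D k \<omega>)) \<and>
      Fg k \<omega> = (\<Sum>i = 1..p (D k \<omega>). F (X k \<omega> + D k \<omega> *\<^sub>R G k \<omega>) (xigs k i \<omega>))
        / real (p (D k \<omega>))"
    using samples unfolding sample_average_estimates_def H_def by blast
  define I :: "(nat + nat) set" where "I = {1..} <+> {1..}"
  define Z where "Z = case_sum (xis k) (xigs k)"
  define S where "S = PiM I (\<lambda>_. N)"
  define \<Phi> where "\<Phi> = (\<lambda>\<omega>. \<lambda>j\<in>I. Z j \<omega>)"
  define gens where "gens = {xis k i -` A \<inter> space M | i A. i \<ge> 1 \<and> A \<in> sets N}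
       \<union> {xigs k i -` A \<inter> space M | i A. i \<ge> 1 \<and> A \<in> sets N}"
  define K where "K = sigma (space M) gens"
  have Z_meas: "random_variable N (Z j)" if "j \<in> I" for j
    using iv that by (auto simp: indep_vars_def Z_def I_def)
  have \<Phi>: "random_variable S \<Phi>"
    unfolding S_def \<Phi>_def using Z_meas by (rule measurable_restrict)
  have K: "space K = space M" "sets K = sigma_sets (space M) gens"
  proof -
    have "gens \<subseteq> Pow (space M)"
      by (auto simp: gens_def)
    then show "space K = space M" "sets K = sigma_sets (space M) gens"
      by (simp_all add: K_def)
  qed
  have Z_K: "Z j \<in> K \<rightarrow>\<^sub>M N" if "j \<in> I" for j
  proof (rule measurableI)
    fix A assume A: "A \<in> sets N"
    have "Z j -` A \<inter> space M \<in> gens"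
    proof (cases j)
      case (Inl i)
      then show ?thesis
        unfolding gens_def using that A
        by (intro UnI1 CollectI exI[of _ i] exI[of _ A]) (auto simp: Z_def I_def)
    next
      case (Inr i)
      then show ?thesis
        unfolding gens_def using that A
        by (intro UnI2 CollectI exI[of _ i] exI[of _ A]) (auto simp: Z_def I_def)
    qed
    then show "Z j -` A \<inter> space K \<in> sets K"
      by (simp add: K sigma_sets.Basic)
  next
    fix \<omega> assume "\<omega> \<in> space K"
    then show "Z j \<omega> \<in> space N"
      using measurable_space[OF Z_meas[OF that]] by (simp add: K)
  qed
  have "\<Phi> \<in> K \<rightarrow>\<^sub>M S"
    unfolding S_def \<Phi>_def using Z_K by (rule measurable_restrict)
  then have "{\<Phi> -` B \<inter> space M | B. B \<in> sets S} \<subseteq> sets K"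
    using measurable_sets[of \<Phi> K S] by (auto simp: K(1))
  then have indep_\<Phi>: "indep_set (sets H) {\<Phi> -` B \<inter> space M | B. B \<in> sets S}"
    using indep unfolding indep_sets2_eq K(2) gens_def by blast
  define dev where "dev = (\<lambda>n \<omega> \<phi>. (\<Sum>i = 1..n. F (X k \<omega>) (\<phi> (Inl i))) / real n
    - (\<Sum>i = 1..n. F (X k \<omega> + D k \<omega> *\<^sub>R G k \<omega>) (\<phi> (Inr i))) / real n
    - (f (X k \<omega>) - f (X k \<omega> + D k \<omega> *\<^sub>R G k \<omega>)))"
  define E where "E = {z \<in> space (H \<Otimes>\<^sub>M S).
    \<bar>dev (p (D k (fst z))) (fst z) (snd z)\<bar> \<ge> \<alpha> * D k (fst z) powr q}"
  have [measurable]: "X k \<in> borel_measurable H" "D k \<in> borel_measurable H" "G k \<in> borel_measurable H"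
    unfolding H_def
    using iterate_stepsize_measurable_history[of k k] direction_measurable_history[of k k] by auto
  have F_comp: "(\<lambda>z. F (a z) (b z)) \<in> borel_measurable L"
    if "a \<in> borel_measurable L" "b \<in> L \<rightarrow>\<^sub>M N" for a b and L :: "('w \<times> (nat + nat \<Rightarrow> 's)) measure"
    using measurable_compose[OF measurable_Pair[OF that] F] by simp
  have coord: "(\<lambda>z. snd z j) \<in> H \<Otimes>\<^sub>M S \<rightarrow>\<^sub>M N" if "j \<in> I" for j
    unfolding S_def by (rule measurable_compose[OF measurable_snd measurable_component_singleton[OF that]])
  have trial: "(\<lambda>z. X k (fst z) + D k (fst z) *\<^sub>R G k (fst z)) \<in> borel_measurable (H \<Otimes>\<^sub>M S)"
    by measurable
  have sums: "(\<lambda>z. \<Sum>i = 1..n. F (X k (fst z)) (snd z (Inl i))) \<in> borel_measurable (H \<Otimes>\<^sub>M S)"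
    "(\<lambda>z. \<Sum>i = 1..n. F (X k (fst z) + D k (fst z) *\<^sub>R G k (fst z)) (snd z (Inr i)))
      \<in> borel_measurable (H \<Otimes>\<^sub>M S)" for n
    by (intro borel_measurable_sum F_comp coord trial; force simp: I_def)+
  \<comment> \<open>First for a fixed number of samples; the random number takes countably many values.\<close>
  have "(\<lambda>z. dev n (fst z) (snd z)) \<in> borel_measurable (H \<Otimes>\<^sub>M S)" for n
    unfolding dev_def
    by (intro borel_measurable_diff borel_measurable_divide borel_measurable_const sums
        measurable_compose[OF trial f]) measurable
  then have [measurable]: "(\<lambda>z. dev (p (D k (fst z))) (fst z) (snd z)) \<in> borel_measurable (H \<Otimes>\<^sub>M S)"
    by (rule measurable_compose_countable) measurable
  have E: "E \<in> sets (H \<Otimes>\<^sub>M S)"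
    unfolding E_def by measurable
  have in_E: "(\<omega>, \<Phi> \<omega>') \<in> E \<longleftrightarrow> \<bar>dev (p (D k \<omega>)) \<omega> (\<lambda>j. Z j \<omega>')\<bar> \<ge> \<alpha> * D k \<omega> powr q"
    if "\<omega> \<in> space M" "\<omega>' \<in> space M" for \<omega> \<omega>'
  proof -
    have "(\<omega>, \<Phi> \<omega>') \<in> space (H \<Otimes>\<^sub>M S)"
      using that measurable_space[OF \<Phi>] by (simp add: space_pair_measure sp)
    moreover have "dev n \<omega> (\<Phi> \<omega>') = dev n \<omega> (\<lambda>j. Z j \<omega>')" for n
      unfolding dev_def \<Phi>_def I_def
      by (intro arg_cong2[where f = "(-)"] arg_cong2[where f = "(/)"] sum.cong refl) auto
    ultimately show ?thesis
      by (simp add: E_def)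
  qed
  have event: "{\<omega> \<in> space M.
      \<bar>Fe k \<omega> - Fg k \<omega> - (f (X k \<omega>) - f (X k \<omega> + D k \<omega> *\<^sub>R G k \<omega>))\<bar> \<ge> \<alpha> * D k \<omega> powr q}
    = {\<omega> \<in> space M. (\<omega>, \<Phi> \<omega>) \<in> E}"
    using in_E est by (auto simp: dev_def Z_def)
  have bound: "prob {\<omega>' \<in> space M. (\<omega>, \<Phi> \<omega>') \<in> E} \<le> \<epsilon> / \<alpha> powr (q / (q - 1))"
    if \<omega>: "\<omega> \<in> space M" for \<omega>
  proof -
    have "{\<omega>' \<in> space M. (\<omega>, \<Phi> \<omega>') \<in> E}
      = {\<omega>' \<in> space M. \<bar>dev (p (D k \<omega>)) \<omega> (\<lambda>j. Z j \<omega>')\<bar> \<ge> \<alpha> * D k \<omega> powr q}"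
      using in_E[OF \<omega>] by blast
    also have "prob \<dots> \<le> \<epsilon> / \<alpha> powr (q / (q - 1))"
      unfolding dev_def
    proof (rule frozen[OF iv[folded Z_def] _ D_pos[OF \<omega>] \<alpha>])
      show "distr M N (Z j) = Xi" if "j \<in> {1..} <+> {1..}" for j
        using that law by (auto simp: Z_def)
    qed
    finally show ?thesis .
  qed
  show "AE \<omega> in M. real_cond_exp M (history M G Fe Fg k)
    (indicator {\<omega> \<in> space M.
      \<bar>Fe k \<omega> - Fg k \<omega> - (f (X k \<omega>) - f (X k \<omega> + D k \<omega> *\<^sub>R G k \<omega>))\<bar> \<ge> \<alpha> * D k \<omega> powr q}) \<omega>
    \<le> \<epsilon> / \<alpha> powr (q / (q - 1))"
    unfolding event H_def[symmetric]
    using real_cond_exp_indicator_freeze[OF sub \<Phi> indep_\<Phi> E] bound by auto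
qed

text \<open>The constants $C$ and $B$, the function $p$ and hence $\epsilon$ depend only on the oracle and $q$,
  so they can be chosen before the run of the algorithm. The balance equation for $s$ is kept
  implicit because it is the same in both regimes of $q$.\<close>

lemma tail_bound_satisfiable_by_sample_averages:
  fixes N Xi :: "'s measure" and f :: "real ^ 'n \<Rightarrow> real" and F :: "real ^ 'n \<Rightarrow> 's \<Rightarrow> real"
    and q r s B :: real
  assumes Xi: "prob_space Xi" "sets Xi = sets N"
    and F: "case_prod F \<in> borel_measurable (borel \<Otimes>\<^sub>M N)"
    and q: "q > 1" and r: "r = q / (q - 1)" and s: "s * (r - max 1 (r / 2)) = q * r"
    and F_int: "\<And>x. integrable Xi (F x)" and mean: "\<And>x. (\<integral>z. F x z \<partial>Xi) = f x"
    and r_int: "\<And>x. integrable Xi (\<lambda>z. \<bar>F x z - f x\<bar> powr r)"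
    and r_le: "\<And>x. (\<integral>z. \<bar>F x z - f x\<bar> powr r \<partial>Xi) \<le> B"
  shows "tail_bound_satisfiable TYPE('w) N Xi f F q s"
proof -
  define e where "e = max 1 (r / 2)"
  have r1: "r > 1"
    using q by (simp add: r field_simps)
  then have e: "e < r"
    by (simp add: e_def)
  have "s = q * r / (r - e)"
    using s[folded e_def] e by (simp add: eq_divide_eq)
  then have s0: "s > 0"
    using q r1 e by simp
  obtain C where C: "C \<ge> 1"
    and tangent: "\<And>x y (n :: nat). n \<ge> 1 \<Longrightarrow>
      \<bar>x + y\<bar> powr r \<le> (1 + 1 / (2 * real n)) * \<bar>x\<bar> powr r
        + r * (sgn x * \<bar>x\<bar> powr (r - 1)) * y + C * real n powr (max 1 (r / 2) - 1) * \<bar>y\<bar> powr r"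
    by (rule powr_tangent_bound[OF r1]) blast
  have "0 \<le> (\<integral>z. \<bar>F 0 z - f 0\<bar> powr r \<partial>Xi)"
    by simp
  then have B: "B \<ge> 0"
    using r_le[of 0] by linarith
  define p :: "real \<Rightarrow> nat" where "p = (\<lambda>\<delta>. nat \<lceil>\<delta> powr (- s)\<rceil>)"
  note p = ceiling_powr_sample_size[OF s0 p_def]
  \<comment> \<open>The summand 1 keeps \<open>\<epsilon>\<close> positive when the oracle is exact, that is when \<open>B = 0\<close>.\<close>
  define \<epsilon> where "\<epsilon> = 2 * C * B * 2 powr e + 1"
  have F_meas: "F x \<in> borel_measurable N" for x
    using measurable_compose[OF measurable_Pair1' F, of x] by simp
  interpret Xi: prob_space Xi
    by (rule Xi)
  have F': "case_prod F \<in> borel_measurable (borel \<Otimes>\<^sub>M Xi)"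
    using F by (simp cong: measurable_cong_sets sets_pair_measure_cong add: Xi(2))
  have "(\<lambda>x. \<integral>z. F x z \<partial>Xi) \<in> borel_measurable borel"
    using F' by (rule Xi.borel_measurable_lebesgue_integral)
  then have f_meas: "f \<in> borel_measurable borel"
    by (simp add: mean)
  show ?thesis
    unfolding tail_bound_satisfiable_def
  proof (intro exI[of _ p] exI[of _ \<epsilon>] conjI allI impI)
    show "\<epsilon> > 0"
      using B C by (simp add: \<epsilon>_def add_nonneg_pos)
  next
    fix M :: "'w measure" and U X D G Fe Fg
    assume "stochastic_dfo M U X D G Fe Fg \<and> sample_average_estimates M N Xi F p X D G Fe Fg"
    then interpret stochastic_dfo M U X D G Fe Fg
      by simp
    show "tail_bound_condition M f q \<epsilon> X D G Fe Fg"
    proof (rule tail_bound_from_frozen_bound[OF F f_meas p(4)])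
      show "sample_average_estimates M N Xi F p X D G Fe Fg"
        using \<open>_ \<and> _\<close> by simp
      fix Z :: "nat + nat \<Rightarrow> 'w \<Rightarrow> 's" and x y :: "real ^ 'n" and \<delta> \<alpha> :: real
      assume iv: "indep_vars (\<lambda>_. N) Z ({1..} <+> {1..})"
        and law: "\<And>j. j \<in> {1..} <+> {1..} \<Longrightarrow> distr M N (Z j) = Xi" and \<delta>: "\<delta> > 0" and \<alpha>: "\<alpha> > 0"
      have "prob {\<omega> \<in> space M. \<bar>(\<Sum>i = 1..p \<delta>. F x (Z (Inl i) \<omega>)) / real (p \<delta>)
          - (\<Sum>i = 1..p \<delta>. F y (Z (Inr i) \<omega>)) / real (p \<delta>) - (f x - f y)\<bar> \<ge> \<alpha> * \<delta> powr q}
        \<le> 2 * C * B * (2 * real (p \<delta>)) powr max 1 (r / 2) / (real (p \<delta>) * (\<alpha> * \<delta> powr q)) powr r"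
        using p(2)[OF \<delta>] \<alpha> \<delta>
        by (intro sample_average_difference_tail[OF r1 C tangent iv law F_meas F_int mean r_int r_le]) auto
      also have "\<dots> = 2 * C * B * ((2 * real (p \<delta>)) powr e / (real (p \<delta>) * (\<alpha> * \<delta> powr q)) powr r)"
        by (simp add: e_def)
      also have "\<dots> \<le> 2 * C * B * (2 powr e / \<alpha> powr r)"
        using sample_size_exponent_cancels[OF \<delta> \<alpha> e s[folded e_def] p(1)] B C
        by (intro mult_left_mono) auto
      also have "\<dots> \<le> \<epsilon> / \<alpha> powr r"
        by (simp add: \<epsilon>_def divide_right_mono)
      finally show "prob {\<omega> \<in> space M. \<bar>(\<Sum>i = 1..p \<delta>. F x (Z (Inl i) \<omega>)) / real (p \<delta>)
          - (\<Sum>i = 1..p \<delta>. F y (Z (Inr i) \<omega>)) / real (p \<delta>) - (f x - f y)\<bar> \<ge> \<alpha> * \<delta> powr q}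
        \<le> \<epsilon> / \<alpha> powr (q / (q - 1))"
        by (simp add: r)
    qed
  qed (use p in auto)
qed

theorem theorem2p4:
  fixes P :: "'p measure" and N :: "'s measure" and \<xi> :: "'p \<Rightarrow> 's"
    and f :: "real ^ 'n \<Rightarrow> real" and F :: "real ^ 'n \<Rightarrow> 's \<Rightarrow> real"
    and fstar q r Mr :: real
  assumes "\<forall>x. \<exists>u>0. \<exists>L. L-lipschitz_on (ball x u) f"
    and "bdd_below (range f)" and "(INF x. f x) = fstar"
    and "prob_space P" and "\<xi> \<in> P \<rightarrow>\<^sub>M N"
    and "case_prod F \<in> borel_measurable (borel \<Otimes>\<^sub>M N)"
    and "q > 1" and "r = q / (q - 1)"
    and "\<forall>x. integrable P (\<lambda>z. F x (\<xi> z)) \<and> f x = (\<integral>z. F x (\<xi> z) \<partial>P)"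
    and "\<forall>x. integrable P (\<lambda>z. \<bar>F x (\<xi> z) - f x\<bar> powr r) \<and>
             (\<integral>z. \<bar>F x (\<xi> z) - f x\<bar> powr r \<partial>P) \<le> Mr"
  shows "(q > 2 \<longrightarrow> tail_bound_satisfiable TYPE('w) N (distr P N \<xi>) f F q (q\<^sup>2)) \<and>
         (q \<le> 2 \<longrightarrow> tail_bound_satisfiable TYPE('w) N (distr P N \<xi>) f F q (2 * q))"
proof -
  note \<xi> = assms(5) and F = assms(6) and q = assms(7) and r = assms(8)
  have Xi: "prob_space (distr P N \<xi>)"
    using assms(4) \<xi> by (rule prob_space.prob_space_distr)
  have F_meas: "F x \<in> borel_measurable N" for x
    using measurable_compose[OF measurable_Pair1' F, of x] by simp
  have dev_meas: "(\<lambda>z. \<bar>F x z - f x\<bar> powr r) \<in> borel_measurable N" for x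
    by (intro powr_real_measurable borel_measurable_abs borel_measurable_diff
        borel_measurable_const F_meas)
  have satisfiable: "tail_bound_satisfiable TYPE('w) N (distr P N \<xi>) f F q s"
    if "s * (r - max 1 (r / 2)) = q * r" for s
  proof (rule tail_bound_satisfiable_by_sample_averages[OF Xi _ F q r that])
    fix x
    show "integrable (distr P N \<xi>) (F x)" "(\<integral>z. F x z \<partial>distr P N \<xi>) = f x"
      using assms(9) by (simp_all add: integrable_distr_eq[OF \<xi> F_meas] integral_distr[OF \<xi> F_meas])
    show "integrable (distr P N \<xi>) (\<lambda>z. \<bar>F x z - f x\<bar> powr r)"
        "(\<integral>z. \<bar>F x z - f x\<bar> powr r \<partial>distr P N \<xi>) \<le> Mr"
      using assms(10)
      by (simp_all add: integrable_distr_eq[OF \<xi> dev_meas] integral_distr[OF \<xi> dev_meas])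
  qed simp
  show ?thesis
  proof (intro conjI impI satisfiable)
    assume "q > 2"
    then have "max 1 (r / 2) = 1"
      by (simp add: r field_simps)
    then show "q\<^sup>2 * (r - max 1 (r / 2)) = q * r"
      using q by (simp add: r field_simps power2_eq_square)
  next
    assume "q \<le> 2"
    then have "max 1 (r / 2) = r / 2"
      using q by (simp add: r field_simps)
    then show "2 * q * (r - max 1 (r / 2)) = q * r"
      by simp
  qed
qed

end
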